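(* Let $K$ be a field, $G$ a finite group and $\mathcal{C}\leq KG$ a nonzero $G$-code. Then $d(\mathcal{C})\cdot\dim\mathcal{C}=|G|$ if and only if there exist a subgroup $H\leq G$ and an element $c\in KH$ such that $|H|=d(\mathcal{C})$, the right ideal $cKH$ of $KH$ has $K$-dimension $1$, and $\mathcal{C}=cKG$.
   Context: $KG$ is the group algebra of $G$ over $K$, and for $H\leq G$ the group algebra $KH$ is viewed as a subalgebra of $KG$. A $G$-code over $K$ is a right ideal $\mathcal{C}$ of $KG$ (written $\mathcal{C}\leq KG$); $\dim\mathcal{C}$ is its dimension over $K$. For $f=\sum_{g\in G}a_g g\in KG$ the weight is $\mathrm{wt}(f)=|\{g\in G\mid a_g\neq 0\}|$, and the minimum distance of a nonzero $G$-code is $d(\mathcal{C})=\min\{\mathrm{wt}(c)\mid c\in\mathcal{C},\ c\neq 0\}$. *)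

theory Defs
  imports Complex_Main "HOL-Algebra.Ideal" "HOL-Library.Function_Algebras"
begin

text \<open>
  The group algebra \<open>KG\<close> of a finite group \<open>G\<close> over a field \<open>K\<close> (the type \<^typ>\<open>'k\<close>):
  the element \<open>\<Sum>g\<in>G. a\<^sub>g g\<close> is the coefficient function \<open>g \<mapsto> a\<^sub>g\<close>, extended by \<open>0\<close> outside
  the carrier. With this convention the algebra of a subgroup \<open>H\<close>, that is
  \<open>group_algebra (G\<lparr>carrier := H\<rparr>)\<close>, is literally a subset of \<open>KG\<close>. The product is convolution;
  the pointwise product of functions from \<^theory>\<open>HOL-Library.Function_Algebras\<close> plays no role.
\<close>

definition group_algebra :: "('g, 'm) monoid_scheme \<Rightarrow> ('g \<Rightarrow> 'k::field) ring" where
  "group_algebra G =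
     \<lparr>carrier = {f. \<forall>x. x \<notin> carrier G \<longrightarrow> f x = 0},
      mult = (\<lambda>f h x. \<Sum>(y, z) \<in> {(y, z). y \<in> carrier G \<and> z \<in> carrier G \<and> y \<otimes>\<^bsub>G\<^esub> z = x}. f y * h z),
      one = (\<lambda>x. if x = \<one>\<^bsub>G\<^esub> then 1 else 0),
      zero = 0,
      add = (+)\<rparr>"

definition scale_fun :: "'k::field \<Rightarrow> ('g \<Rightarrow> 'k) \<Rightarrow> 'g \<Rightarrow> 'k" where
  "scale_fun a f = (\<lambda>x. a * f x)"

locale right_ideal = additive_subgroup I R + ring R for I and R (structure) +
  assumes right_closed: "\<lbrakk>a \<in> I; x \<in> carrier R\<rbrakk> \<Longrightarrow> a \<otimes> x \<in> I"

definition weight :: "('g, 'm) monoid_scheme \<Rightarrow> ('g \<Rightarrow> 'k::field) \<Rightarrow> nat" where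
  "weight G f = card {g \<in> carrier G. f g \<noteq> 0}"

text \<open>Weights are at most \<^term>\<open>order G\<close>, so for finite \<open>G\<close> and \<^prop>\<open>C \<noteq> {0}\<close> the minimum below
  is taken over a finite nonempty set.\<close>

definition min_distance :: "('g, 'm) monoid_scheme \<Rightarrow> ('g \<Rightarrow> 'k::field) set \<Rightarrow> nat" where
  "min_distance G C = Min {weight G c |c. c \<in> C \<and> c \<noteq> \<zero>\<^bsub>group_algebra G\<^esub>}"

lemma vector_space_scale_fun: "vector_space scale_fun"
  by (unfold_locales) (simp_all add: scale_fun_def fun_eq_iff algebra_simps)

lemma group_algebra_simps [simp]:
  "f \<in> carrier (group_algebra G) \<longleftrightarrow> (\<forall>x. x \<notin> carrier G \<longrightarrow> f x = 0)"
  "\<zero>\<^bsub>group_algebra G\<^esub> = 0"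
  "f \<oplus>\<^bsub>group_algebra G\<^esub> h = f + h"
  "\<one>\<^bsub>group_algebra G\<^esub> = (\<lambda>x. if x = \<one>\<^bsub>G\<^esub> then 1 else 0)"
  by (simp_all add: group_algebra_def)

lemma group_algebra_mult:
  "(f \<otimes>\<^bsub>group_algebra G\<^esub> h) x =
     (\<Sum>(y, z) \<in> {(y, z). y \<in> carrier G \<and> z \<in> carrier G \<and> y \<otimes>\<^bsub>G\<^esub> z = x}. f y * h z)"
  by (simp add: group_algebra_def)

lemma (in group) group_algebra_mult_outside:
  assumes "x \<notin> carrier G"
  shows "(f \<otimes>\<^bsub>group_algebra G\<^esub> h) x = 0"
proof -
  have "{(y, z). y \<in> carrier G \<and> z \<in> carrier G \<and> y \<otimes> z = x} = {}"
    using assms by auto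
  then show ?thesis by (simp only: group_algebra_mult sum.empty)
qed

lemma (in group) group_algebra_mult_inside:
  assumes "x \<in> carrier G"
  shows "(f \<otimes>\<^bsub>group_algebra G\<^esub> h) x = (\<Sum>y\<in>carrier G. f y * h (inv y \<otimes> x))"
proof -
  have "bij_betw (\<lambda>y. (y, inv y \<otimes> x)) (carrier G)
          {(y, z). y \<in> carrier G \<and> z \<in> carrier G \<and> y \<otimes> z = x}"
    using assms
    by (intro bij_betw_byWitness[where f' = fst]) (auto simp: m_assoc[symmetric])
  from sum.reindex_bij_betw[OF this, of "\<lambda>(y, z). f y * h z"] show ?thesis
    by (simp add: group_algebra_mult)
qed

lemma (in group) ring_group_algebra:
  assumes fin: "finite (carrier G)"
  shows "ring (group_algebra G :: ('a \<Rightarrow> 'k::field) ring)"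
proof (rule ringI)
  let ?R = "group_algebra G :: ('a \<Rightarrow> 'k) ring"
  show "abelian_group ?R"
  proof (rule abelian_groupI)
    fix f assume "f \<in> carrier ?R"
    then show "\<exists>h\<in>carrier ?R. h \<oplus>\<^bsub>?R\<^esub> f = \<zero>\<^bsub>?R\<^esub>"
      by (intro bexI[of _ "- f"]) auto
  qed (auto simp: add_ac)
  show "monoid ?R"
  proof (rule monoidI)
    fix f h assume "f \<in> carrier ?R" "h \<in> carrier ?R"
    then show "f \<otimes>\<^bsub>?R\<^esub> h \<in> carrier ?R"
      by (simp add: group_algebra_mult_outside)
  next
    show "\<one>\<^bsub>?R\<^esub> \<in> carrier ?R" by auto
  next
    fix f g h
    show "f \<otimes>\<^bsub>?R\<^esub> g \<otimes>\<^bsub>?R\<^esub> h = f \<otimes>\<^bsub>?R\<^esub> (g \<otimes>\<^bsub>?R\<^esub> h)"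
    proof
      fix x
      show "(f \<otimes>\<^bsub>?R\<^esub> g \<otimes>\<^bsub>?R\<^esub> h) x = (f \<otimes>\<^bsub>?R\<^esub> (g \<otimes>\<^bsub>?R\<^esub> h)) x"
      proof (cases "x \<in> carrier G")
        case True
        have shift: "(\<Sum>y\<in>carrier G. g (inv w \<otimes> y) * h (inv y \<otimes> x))
                  = (\<Sum>u\<in>carrier G. g u * h (inv u \<otimes> (inv w \<otimes> x)))"
          if w: "w \<in> carrier G" for w
        proof -
          have b: "bij_betw (\<lambda>u. w \<otimes> u) (carrier G) (carrier G)"
            using w by (intro bij_betw_byWitness[where f' = "\<lambda>y. inv w \<otimes> y"])
              (auto simp: m_assoc[symmetric])
          have "(\<Sum>y\<in>carrier G. g (inv w \<otimes> y) * h (inv y \<otimes> x))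
              = (\<Sum>u\<in>carrier G. g (inv w \<otimes> (w \<otimes> u)) * h (inv (w \<otimes> u) \<otimes> x))"
            by (rule sum.reindex_bij_betw[OF b, symmetric])
          also have "\<dots> = (\<Sum>u\<in>carrier G. g u * h (inv u \<otimes> (inv w \<otimes> x)))"
            using w True by (intro sum.cong refl)
              (simp add: m_assoc[symmetric] inv_mult_group)
          finally show ?thesis .
        qed
        have "(f \<otimes>\<^bsub>?R\<^esub> g \<otimes>\<^bsub>?R\<^esub> h) x
            = (\<Sum>y\<in>carrier G. \<Sum>w\<in>carrier G. f w * (g (inv w \<otimes> y) * h (inv y \<otimes> x)))"
          using True by (simp add: group_algebra_mult_inside sum_distrib_right mult.assoc)
        also have "\<dots> = (\<Sum>w\<in>carrier G. f w *
                         (\<Sum>y\<in>carrier G. g (inv w \<otimes> y) * h (inv y \<otimes> x)))"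
          by (subst sum.swap) (simp add: sum_distrib_left)
        also have "\<dots> = (f \<otimes>\<^bsub>?R\<^esub> (g \<otimes>\<^bsub>?R\<^esub> h)) x"
          using True by (simp add: group_algebra_mult_inside shift)
        finally show ?thesis .
      qed (simp add: group_algebra_mult_outside)
    qed
  next
    fix f assume f: "f \<in> carrier ?R"
    show "\<one>\<^bsub>?R\<^esub> \<otimes>\<^bsub>?R\<^esub> f = f"
    proof
      fix x
      show "(\<one>\<^bsub>?R\<^esub> \<otimes>\<^bsub>?R\<^esub> f) x = f x"
      proof (cases "x \<in> carrier G")
        case True
        have "(\<one>\<^bsub>?R\<^esub> \<otimes>\<^bsub>?R\<^esub> f) x
            = (\<Sum>y\<in>carrier G. if y = \<one> then f (inv y \<otimes> x) else 0)"
          using True by (simp add: group_algebra_mult_inside if_distrib if_distribR cong: if_cong)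
        also have "\<dots> = f x" using True fin by simp
        finally show ?thesis .
      qed (use f in \<open>simp add: group_algebra_mult_outside del: group_algebra_simps(4)\<close>)
    qed
    show "f \<otimes>\<^bsub>?R\<^esub> \<one>\<^bsub>?R\<^esub> = f"
    proof
      fix x
      show "(f \<otimes>\<^bsub>?R\<^esub> \<one>\<^bsub>?R\<^esub>) x = f x"
      proof (cases "x \<in> carrier G")
        case True
        have "(f \<otimes>\<^bsub>?R\<^esub> \<one>\<^bsub>?R\<^esub>) x = (\<Sum>y\<in>carrier G. if y = x then f y else 0)"
          unfolding group_algebra_mult_inside[OF True]
        proof (intro sum.cong refl)
          fix y assume y: "y \<in> carrier G"
          have "inv y \<otimes> x = \<one> \<longleftrightarrow> y = x"
            using True y by (metis inv_closed inv_equality inv_inv l_inv)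
          then show "f y * \<one>\<^bsub>?R\<^esub> (inv y \<otimes> x) = (if y = x then f y else 0)" by simp
        qed
        also have "\<dots> = f x" using True fin by simp
        finally show ?thesis .
      qed (use f in \<open>simp add: group_algebra_mult_outside del: group_algebra_simps(4)\<close>)
    qed
  qed
  show "(f \<oplus>\<^bsub>?R\<^esub> g) \<otimes>\<^bsub>?R\<^esub> h = f \<otimes>\<^bsub>?R\<^esub> h \<oplus>\<^bsub>?R\<^esub> g \<otimes>\<^bsub>?R\<^esub> h" for f g h
    by (auto simp: fun_eq_iff group_algebra_mult sum.distrib[symmetric] case_prod_unfold algebra_simps)
  show "h \<otimes>\<^bsub>?R\<^esub> (f \<oplus>\<^bsub>?R\<^esub> g) = h \<otimes>\<^bsub>?R\<^esub> f \<oplus>\<^bsub>?R\<^esub> h \<otimes>\<^bsub>?R\<^esub> g" for f g h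
    by (auto simp: fun_eq_iff group_algebra_mult sum.distrib[symmetric] case_prod_unfold algebra_simps)
qed

lemma (in group) subgroup_algebra_consistent:
  assumes fin: "finite (carrier G)" and H: "subgroup H G"
    and f: "f \<in> carrier (group_algebra (G\<lparr>carrier := H\<rparr>))"
    and h: "h \<in> carrier (group_algebra (G\<lparr>carrier := H\<rparr>))"
  shows "f \<otimes>\<^bsub>group_algebra (G\<lparr>carrier := H\<rparr>)\<^esub> h = f \<otimes>\<^bsub>group_algebra G\<^esub> h"
proof
  fix x
  have sub: "H \<subseteq> carrier G" using H by (rule subgroup.subset)
  have "finite {(y, z). y \<in> carrier G \<and> z \<in> carrier G \<and> y \<otimes> z = x}"
    by (rule finite_subset[of _ "carrier G \<times> carrier G"]) (use fin in auto)
  then show "(f \<otimes>\<^bsub>group_algebra (G\<lparr>carrier := H\<rparr>)\<^esub> h) x = (f \<otimes>\<^bsub>group_algebra G\<^esub> h) x"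
    unfolding group_algebra_mult
    by (intro sum.mono_neutral_left) (use sub f h in auto)
qed

end

theory Submission
  imports Defs
begin

text \<open>
  Let \<open>c \<in> C\<close> have weight \<open>d\<close>. A basis \<open>B\<close> of the span of the translates \<open>c g\<close> that consists of
  translates has supports covering \<open>G\<close>, so \<open>|G| \<le> d |B| \<le> d dim C\<close>. If equality holds, then every
  such basis spans \<open>C\<close> and has pairwise disjoint supports. As two translates with different supports
  extend to such a basis, the supports of any two translates are equal or disjoint. Hence the support
  of \<open>c\<close>, translated so as to contain \<open>1\<close>, is a subgroup \<open>H\<close>. For \<open>h \<in> H\<close> some \<open>c h - a c\<close> vanishes
  at \<open>1\<close> and so has weight less than \<open>d\<close>; thus \<open>c h = a c\<close>. Conversely, if \<open>cKH\<close> is a line, then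
  translates of \<open>c\<close> by representatives of the right cosets of \<open>H\<close> span \<open>cKG\<close>, which gives
  \<open>dim C \<le> |G| / d\<close>.
\<close>

section \<open>Linear algebra and supports of coefficient functions\<close>

interpretation fn: vector_space scale_fun
  by (rule vector_space_scale_fun)

lemma scale_fun_apply [simp]: "scale_fun a f x = a * f x"
  by (simp add: scale_fun_def)

lemma sum_fun_apply: "(\<Sum>i\<in>I. F i) x = (\<Sum>i\<in>I. F i x)"
  for F :: "'i \<Rightarrow> 'b \<Rightarrow> 'c::comm_monoid_add"
  by (induction I rule: infinite_finite_induct) auto

text \<open>The functions vanishing at \<open>x\<close> form a subspace. Used in contraposition: if
  some function in the span is nonzero at \<open>x\<close>, then some member of \<open>B\<close>
  is.\<close>

lemma span_vanishes:
  assumes "v \<in> fn.span B" and "\<And>b. b \<in> B \<Longrightarrow> b x = 0"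
  shows "v x = 0"
  using assms(1) by (rule fn.span_induct) (auto simp: fn.subspace_def assms(2))

text \<open>Double counting of the pairs \<open>(b, x)\<close> with
  \<open>b x \<noteq> 0\<close>.\<close>

lemma sum_weight_eq:
  assumes "finite (carrier G)" "finite B"
  shows "(\<Sum>b\<in>B. weight G b) = (\<Sum>x\<in>carrier G. card {b \<in> B. b x \<noteq> 0})"
proof -
  have "(\<Sum>b\<in>B. weight G b) = (\<Sum>b\<in>B. \<Sum>x\<in>carrier G. if b x \<noteq> 0 then 1 else 0)"
    unfolding weight_def using assms by (intro sum.cong refl) (simp add: sum.If_cases Int_def)
  also have "\<dots> = (\<Sum>x\<in>carrier G. \<Sum>b\<in>B. if b x \<noteq> 0 then 1 else 0)"
    by (rule sum.swap)
  also have "\<dots> = (\<Sum>x\<in>carrier G. card {b \<in> B. b x \<noteq> 0})"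
    using assms by (intro sum.cong refl) (simp add: sum.If_cases Int_def)
  finally show ?thesis .
qed

text \<open>For \<open>g\<close> in \<open>G\<close> this is the product of \<open>f\<close> with
  the group element \<open>g\<close> in \<open>KG\<close>: the coefficient at \<open>x\<close> comes
  from the unique \<open>y\<close> with \<open>y g = x\<close>.\<close>

definition right_translate :: "('g, 'm) monoid_scheme \<Rightarrow> 'g \<Rightarrow> ('g \<Rightarrow> 'k::field) \<Rightarrow> 'g \<Rightarrow> 'k" where
  "right_translate G g f = (\<lambda>x. if x \<in> carrier G then f (x \<otimes>\<^bsub>G\<^esub> inv\<^bsub>G\<^esub> g) else 0)"

section \<open>Right translation by group elements\<close>

context group
begin

lemma right_translate_one:
  assumes "f \<in> carrier (group_algebra G)"
  shows "right_translate G \<one> f = f"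
  using assms by (auto simp: right_translate_def fun_eq_iff)

lemma right_translate_mult:
  assumes "g \<in> carrier G" "h \<in> carrier G"
  shows "right_translate G (g \<otimes> h) f = right_translate G h (right_translate G g f)"
  using assms by (auto simp: right_translate_def fun_eq_iff inv_mult_group m_assoc)

lemma right_translate_scale:
  "right_translate G g (scale_fun a f) = scale_fun a (right_translate G g f)"
  by (auto simp: right_translate_def fun_eq_iff)

text \<open>Right multiplication by \<open>inv h\<close> maps the complement of \<open>H\<close>
  into itself, so translating over \<open>G\<close> produces no values outside
  \<open>H\<close>.\<close>

lemma right_translate_subgroup:
  assumes "subgroup H G" "h \<in> H" "f \<in> carrier (group_algebra (G\<lparr>carrier := H\<rparr>))"
  shows "right_translate (G\<lparr>carrier := H\<rparr>) h f = right_translate G h f"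
proof
  fix x
  have "x \<otimes> inv h \<notin> H" if "x \<in> carrier G" "x \<notin> H"
  proof
    assume "x \<otimes> inv h \<in> H"
    then have "x \<otimes> inv h \<otimes> h \<in> H" using assms by (simp add: subgroup.m_closed)
    then show False
      using that assms by (simp add: m_assoc subgroup.mem_carrier)
  qed
  then show "right_translate (G\<lparr>carrier := H\<rparr>) h f x = right_translate G h f x"
    using assms by (auto simp: right_translate_def m_inv_consistent subgroup.mem_carrier)
qed

lemma weight_right_translate:
  assumes g: "g \<in> carrier G"
  shows "weight G (right_translate G g f) = weight G f"
  unfolding weight_def
  by (rule bij_betw_same_card[of "\<lambda>x. x \<otimes> inv g"],
      rule bij_betw_byWitness[where f' = "\<lambda>x. x \<otimes> g"])
    (use g in \<open>auto simp: right_translate_def m_assoc\<close>)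

section \<open>Products and right ideals in terms of translates\<close>

text \<open>Expand \<open>h\<close> in the basis of group elements; in the convolution sum this is
  the substitution of \<open>x \<otimes> inv g\<close> for \<open>y\<close>.\<close>

lemma group_algebra_mult_eq_sum:
  "f \<otimes>\<^bsub>group_algebra G\<^esub> h = (\<Sum>g\<in>carrier G. scale_fun (h g) (right_translate G g f))"
proof
  fix x
  show "(f \<otimes>\<^bsub>group_algebra G\<^esub> h) x = (\<Sum>g\<in>carrier G. scale_fun (h g) (right_translate G g f)) x"
  proof (cases "x \<in> carrier G")
    case True
    have cancel: "x \<otimes> (inv x \<otimes> g) = g" if "g \<in> carrier G" for g
      using True that by (simp add: m_assoc[symmetric])
    have "bij_betw (\<lambda>g. x \<otimes> inv g) (carrier G) (carrier G)"
      by (rule bij_betw_byWitness[where f' = "\<lambda>y. inv y \<otimes> x"])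
        (use True cancel in \<open>auto simp: inv_mult_group m_assoc\<close>)
    from sum.reindex_bij_betw[OF this, of "\<lambda>y. f y * h (inv y \<otimes> x)"] True
    have "(f \<otimes>\<^bsub>group_algebra G\<^esub> h) x
        = (\<Sum>g\<in>carrier G. f (x \<otimes> inv g) * h (inv (x \<otimes> inv g) \<otimes> x))"
      by (simp add: group_algebra_mult_inside)
    also have "\<dots> = (\<Sum>g\<in>carrier G. h g * right_translate G g f x)"
      using True by (intro sum.cong refl) (simp add: right_translate_def inv_mult_group m_assoc)
    finally show ?thesis by (simp add: sum_fun_apply)
  qed (simp add: group_algebra_mult_outside sum_fun_apply right_translate_def)
qed

lemma group_algebra_mult_single:
  assumes "finite (carrier G)" "g \<in> carrier G"
  shows "f \<otimes>\<^bsub>group_algebra G\<^esub> (\<lambda>x. if x = g then a else 0) = scale_fun a (right_translate G g f)"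
proof -
  have "(\<Sum>k\<in>carrier G. scale_fun (if k = g then a else 0) (right_translate G k f))
      = (\<Sum>k\<in>carrier G. if k = g then scale_fun a (right_translate G k f) else 0)"
    by (intro sum.cong refl) auto
  then show ?thesis
    using assms by (simp add: group_algebra_mult_eq_sum)
qed

text \<open>A product is a combination of translates of \<open>f\<close>. Conversely, each translate
  is \<open>f\<close> times a group element, and the multiples of \<open>f\<close> form a
  subspace.\<close>

lemma group_algebra_l_coset_eq_span:
  assumes fin: "finite (carrier G)"
  shows "f <#\<^bsub>group_algebra G\<^esub> carrier (group_algebra G)
       = fn.span ((\<lambda>g. right_translate G g f) ` carrier G)" (is "?I = fn.span ?T")
proof
  show "?I \<subseteq> fn.span ?T"
    unfolding l_coset_def group_algebra_mult_eq_sum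
    by (force intro: fn.span_sum fn.span_scale fn.span_base)
  show "fn.span ?T \<subseteq> ?I"
  proof (rule fn.span_minimal)
    show "?T \<subseteq> ?I"
    proof safe
      fix g assume "g \<in> carrier G"
      then have "right_translate G g f = f \<otimes>\<^bsub>group_algebra G\<^esub> (\<lambda>x. if x = g then 1 else 0)"
        using fin by (simp add: group_algebra_mult_single)
      with \<open>g \<in> carrier G\<close> show "right_translate G g f \<in> ?I"
        unfolding l_coset_def by auto
    qed
    have "f \<otimes>\<^bsub>group_algebra G\<^esub> 0 = 0"
      by (simp add: group_algebra_mult_eq_sum)
    moreover have "f \<otimes>\<^bsub>group_algebra G\<^esub> h + f \<otimes>\<^bsub>group_algebra G\<^esub> k
        = f \<otimes>\<^bsub>group_algebra G\<^esub> (h + k)" for h k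
      by (simp add: group_algebra_mult_eq_sum fn.scale_left_distrib sum.distrib)
    moreover have "scale_fun a (f \<otimes>\<^bsub>group_algebra G\<^esub> h)
        = f \<otimes>\<^bsub>group_algebra G\<^esub> scale_fun a h" for a h
      by (simp add: group_algebra_mult_eq_sum fn.scale_sum_right)
    ultimately show "fn.subspace ?I"
      unfolding fn.subspace_def l_coset_def
      by auto
  qed
qed

text \<open>Right multiplication by \<open>a\<close> times a group element \<open>g\<close> gives
  translates for \<open>a = 1\<close> and scalar multiples for \<open>g = \<one>\<close>, so a right
  ideal is a subspace although its definition mentions no scalars.\<close>

lemma right_ideal_group_algebra:
  assumes fin: "finite (carrier G)" and C: "right_ideal C (group_algebra G)"
  shows right_ideal_carrier: "f \<in> C \<Longrightarrow> f \<in> carrier (group_algebra G)"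
    and right_ideal_translate: "f \<in> C \<Longrightarrow> g \<in> carrier G \<Longrightarrow> right_translate G g f \<in> C"
    and right_ideal_subspace: "fn.subspace C"
proof -
  \<comment> \<open>The unit of the group, kept apart from the unit of the group algebra.\<close>
  note G_one = one_closed
  interpret right_ideal C "group_algebra G" by (rule C)
  have car: "f \<in> carrier (group_algebra G)" if "f \<in> C" for f
    using that by (rule a_Hcarr)
  then show "f \<in> C \<Longrightarrow> f \<in> carrier (group_algebra G)" .
  have tr: "scale_fun a (right_translate G g f) \<in> C" if "f \<in> C" "g \<in> carrier G" for a g f
    using right_closed[OF that(1), of "\<lambda>x. if x = g then a else 0"] that fin
    by (auto simp: group_algebra_mult_single)
  show "f \<in> C \<Longrightarrow> g \<in> carrier G \<Longrightarrow> right_translate G g f \<in> C"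
    using tr[of f g 1] by simp
  show "fn.subspace C"
    unfolding fn.subspace_def
  proof safe
    show "0 \<in> C" using additive_subgroup.zero_closed[OF additive_subgroup_axioms] by simp
    show "f + h \<in> C" if "f \<in> C" "h \<in> C" for f h
      using additive_subgroup.a_closed[OF additive_subgroup_axioms that] by simp
    show "scale_fun a f \<in> C" if "f \<in> C" for a f
      using tr[OF that G_one, of a] car[OF that] by (simp only: right_translate_one)
  qed
qed

text \<open>The space of all functions on the type may have infinite dimension, but
  \<open>KG\<close> is spanned by its finitely many group elements, which bounds every independent
  set in it.\<close>

lemma independent_in_group_algebra:
  fixes V :: "('a \<Rightarrow> 'k::field) set"
  assumes fin: "finite (carrier G)" and V: "V \<subseteq> carrier (group_algebra G)"
    and B: "fn.independent B" "B \<subseteq> V"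
  shows "finite B" and "card B \<le> fn.dim V"
    and "fn.subspace V \<Longrightarrow> card B = fn.dim V \<Longrightarrow> fn.span B = V"
proof -
  let ?D = "(\<lambda>g x. if x = g then 1 else 0 :: 'k) ` carrier G"
  have D: "f \<in> fn.span ?D" if "f \<in> carrier (group_algebra G)" for f
  proof -
    have "f = (\<Sum>g\<in>carrier G. scale_fun (f g) (\<lambda>x. if x = g then 1 else 0))"
      using that fin by (auto simp: fun_eq_iff sum_fun_apply if_distrib cong: if_cong)
    also have "\<dots> \<in> fn.span ?D"
      by (intro fn.span_sum fn.span_scale fn.span_base) simp
    finally show ?thesis .
  qed
  have indep: "finite A \<and> card A \<le> fn.dim V" if "fn.independent A" "A \<subseteq> V" for A
  proof -
    obtain W where W: "W \<subseteq> V" "fn.independent W" "V \<subseteq> fn.span W" "card W = fn.dim V"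
      by (rule fn.basis_exists)
    have "finite W"
      using fn.independent_span_bound[of ?D W] W V D fin by blast
    then show ?thesis
      using fn.independent_span_bound[of W A] W that by auto
  qed
  from indep B show "finite B" "card B \<le> fn.dim V" by blast+
  assume V': "fn.subspace V" and eq: "card B = fn.dim V"
  have "x \<in> fn.span B" if "x \<in> V" for x
  \<comment> \<open>A vector of \<open>V\<close> outside the span would enlarge \<open>B\<close> to
    an independent set with more than \<open>fn.dim V\<close> elements.\<close>
  proof (rule ccontr)
    assume x: "x \<notin> fn.span B"
    then have "x \<notin> B" using fn.span_base by blast
    moreover have "fn.independent (insert x B)"
      using x B by (intro fn.independent_insertI)
    ultimately show False
      using indep[of "insert x B"] \<open>finite B\<close> that B eq by simp
  qed
  then show "fn.span B = V"
    using fn.span_minimal[OF B(2) V'] by blast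
qed

section \<open>The counting bound and its equality case\<close>

text \<open>\<open>B\<close> is a maximal independent set of translates containing \<open>A\<close>.
  Translates reach every point of \<open>G\<close>, hence so do the supports of \<open>B\<close>; as
  all translates have the weight of \<open>c\<close>, the incidences number
  \<open>card B * weight G c\<close>. The set \<open>A\<close> allows prescribing members of
  \<open>B\<close>.\<close>

lemma translate_basis:
  assumes fin: "finite (carrier G)" and C: "right_ideal C (group_algebra G)"
    and c: "c \<in> C" "c \<noteq> 0"
    and A: "fn.independent A" "A \<subseteq> (\<lambda>g. right_translate G g c) ` carrier G"
  obtains B where "A \<subseteq> B" "B \<subseteq> (\<lambda>g. right_translate G g c) ` carrier G"
    "finite B" "card B \<le> fn.dim C" "card B = fn.dim C \<longrightarrow> fn.span B = C"
    "\<forall>x\<in>carrier G. 1 \<le> card {b \<in> B. b x \<noteq> 0}"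
    "(\<Sum>x\<in>carrier G. card {b \<in> B. b x \<noteq> 0}) = card B * weight G c"
proof -
  let ?T = "(\<lambda>g. right_translate G g c) ` carrier G"
  note ideal = right_ideal_group_algebra[OF fin C]
  obtain B where B: "A \<subseteq> B" "B \<subseteq> ?T" "fn.independent B" "?T \<subseteq> fn.span B"
    using fn.maximal_independent_subset_extend[OF A(2,1)] by blast
  have sub: "B \<subseteq> C" using B(2) c(1) ideal(2) by blast
  have "C \<subseteq> carrier (group_algebra G)" using ideal(1) by blast
  note basis = independent_in_group_algebra[OF fin this B(3) sub]
  have cover: "1 \<le> card {b \<in> B. b x \<noteq> 0}" if x: "x \<in> carrier G" for x
  proof -
    obtain y where y: "c y \<noteq> 0" using c(2) by (auto simp: fun_eq_iff)
    with ideal(1)[OF c(1)] have yG: "y \<in> carrier G" by auto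
    \<comment> \<open>Translation by \<open>?g\<close> carries the support point \<open>y\<close> of
      \<open>c\<close> to \<open>x\<close>.\<close>
    let ?g = "inv y \<otimes> x"
    have "x \<otimes> inv ?g = y"
      using x yG by (simp add: inv_mult_group m_assoc[symmetric])
    then have "right_translate G ?g c x \<noteq> 0"
      using x y by (simp add: right_translate_def)
    moreover have "right_translate G ?g c \<in> fn.span B"
      using x yG by (intro subsetD[OF B(4)] imageI) simp
    ultimately have "\<exists>b\<in>B. b x \<noteq> 0"
      using span_vanishes[of "right_translate G ?g c" B x] by blast
    then have "{b \<in> B. b x \<noteq> 0} \<noteq> {}" by blast
    then show ?thesis
      using basis(1) by (simp add: Suc_le_eq card_gt_0_iff)
  qed
  have "(\<Sum>x\<in>carrier G. card {b \<in> B. b x \<noteq> 0}) = (\<Sum>b\<in>B. weight G b)"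
    using fin basis(1) by (simp add: sum_weight_eq)
  also have "\<dots> = (\<Sum>b\<in>B. weight G c)"
    using B(2) by (intro sum.cong refl) (auto simp: weight_right_translate)
  finally have total: "(\<Sum>x\<in>carrier G. card {b \<in> B. b x \<noteq> 0}) = card B * weight G c"
    by simp
  show thesis
    using that[OF B(1,2) basis(1,2) _ _ total] basis(3)[OF ideal(3)] cover by blast
qed

text \<open>Each point of \<open>G\<close> occurs at least once among the
  \<open>card B * weight G c\<close> incidences, and \<open>card B\<close> is at most the
  dimension.\<close>

lemma order_le_weight_times_dim:
  assumes fin: "finite (carrier G)" and C: "right_ideal C (group_algebra G)"
    and c: "c \<in> C" "c \<noteq> 0"
  shows "order G \<le> weight G c * fn.dim C"
proof -
  obtain B where B: "{} \<subseteq> B" "B \<subseteq> (\<lambda>g. right_translate G g c) ` carrier G"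
    "finite B" "card B \<le> fn.dim C" "card B = fn.dim C \<longrightarrow> fn.span B = C"
    "\<forall>x\<in>carrier G. 1 \<le> card {b \<in> B. b x \<noteq> 0}"
    "(\<Sum>x\<in>carrier G. card {b \<in> B. b x \<noteq> 0}) = card B * weight G c"
    by (rule translate_basis[OF fin C c fn.independent_empty empty_subsetI])
  have "order G = (\<Sum>x\<in>carrier G. 1)" by (simp add: order_def)
  also have "\<dots> \<le> card B * weight G c"
    unfolding B(7)[symmetric] using B(6) by (intro sum_mono) simp
  also have "\<dots> \<le> fn.dim C * weight G c"
    using B(4) by simp
  finally show ?thesis by (simp add: mult.commute)
qed

text \<open>Under \<open>tight\<close> both inequalities of the count become equalities:
  \<open>B\<close> has \<open>fn.dim C\<close> elements, and its supports partition
  \<open>G\<close>.\<close>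

lemma tight_translate_basis:
  assumes fin: "finite (carrier G)" and C: "right_ideal C (group_algebra G)"
    and c: "c \<in> C" "c \<noteq> 0"
    and A: "fn.independent A" "A \<subseteq> (\<lambda>g. right_translate G g c) ` carrier G"
    and tight: "weight G c * fn.dim C = order G"
  obtains B where "A \<subseteq> B" "B \<subseteq> (\<lambda>g. right_translate G g c) ` carrier G" "fn.span B = C"
    "\<forall>x\<in>carrier G. card {b \<in> B. b x \<noteq> 0} = 1"
proof -
  obtain B where B: "A \<subseteq> B" "B \<subseteq> (\<lambda>g. right_translate G g c) ` carrier G"
    "finite B" "card B \<le> fn.dim C" "card B = fn.dim C \<longrightarrow> fn.span B = C"
    "\<forall>x\<in>carrier G. 1 \<le> card {b \<in> B. b x \<noteq> 0}"
    "(\<Sum>x\<in>carrier G. card {b \<in> B. b x \<noteq> 0}) = card B * weight G c"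
    by (rule translate_basis[OF fin C c A])
  have ge: "(\<Sum>x\<in>carrier G. 1) \<le> (\<Sum>x\<in>carrier G. card {b \<in> B. b x \<noteq> 0})"
    using B(6) by (intro sum_mono) simp
  then have "fn.dim C * weight G c \<le> card B * weight G c"
    using tight B(7) by (simp add: order_def mult.commute)
  \<comment> \<open>Allows cancelling the weight: a zero weight would make \<open>order G\<close>
    zero.\<close>
  moreover have "weight G c \<noteq> 0"
    using tight fin order_gt_0_iff_finite by (metis mult_0 less_irrefl)
  ultimately have dim: "card B = fn.dim C"
    using B(4) by simp
  then have "(\<Sum>x\<in>carrier G. 1) = (\<Sum>x\<in>carrier G. card {b \<in> B. b x \<noteq> 0})"
    using tight B(7) by (simp add: order_def mult.commute)
  \<comment> \<open>Termwise comparable sums with the same value agree term by term.\<close>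
  then have "1 = card {b \<in> B. b x \<noteq> 0}" if "x \<in> carrier G" for x
    by (rule sum_mono_inv) (use B(6) that fin in auto)
  then show thesis
    using that[OF B(1,2)] B(5) dim by simp
qed

text \<open>Nonzero translates with different supports are not proportional, so both belong to a
  common basis of translates. Its supports are disjoint, which contradicts the common point
  \<open>x\<close>.\<close>

lemma tight_translates_support:
  assumes fin: "finite (carrier G)" and C: "right_ideal C (group_algebra G)"
    and c: "c \<in> C" "c \<noteq> 0"
    and tight: "weight G c * fn.dim C = order G"
    and gk: "g \<in> carrier G" "k \<in> carrier G"
    and x: "right_translate G g c x \<noteq> 0" "right_translate G k c x \<noteq> 0"
  shows "right_translate G g c y = 0 \<longleftrightarrow> right_translate G k c y = 0"
proof (rule ccontr)
  let ?u = "right_translate G g c" and ?v = "right_translate G k c"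
  assume y: "\<not> ?thesis"
  have xG: "x \<in> carrier G" using x(1) by (auto simp: right_translate_def split: if_splits)
  have "?u \<notin> fn.span {?v}"
  proof
    assume "?u \<in> fn.span {?v}"
    then obtain a where a: "?u = scale_fun a ?v"
      by (auto simp: fn.span_singleton)
    then have "a \<noteq> 0" using x(1) by auto
    moreover have "?u y = a * ?v y" by (subst a) simp
    ultimately show False using y by simp
  qed
  moreover have "fn.independent {?v}" using x(2) by auto
  ultimately have "fn.independent {?u, ?v}"
    by (rule fn.independent_insertI)
  moreover have "{?u, ?v} \<subseteq> (\<lambda>g. right_translate G g c) ` carrier G"
    using gk by simp
  ultimately obtain B where B: "{?u, ?v} \<subseteq> B"
    "B \<subseteq> (\<lambda>g. right_translate G g c) ` carrier G" "fn.span B = C"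
    "\<forall>x\<in>carrier G. card {b \<in> B. b x \<noteq> 0} = 1"
    by (rule tight_translate_basis[OF fin C c _ _ tight])
  from B(4)[rule_format, OF xG] obtain b where "{b \<in> B. b x \<noteq> 0} = {b}"
    by (auto simp: card_1_singleton_iff)
  then have "?u = b" "?v = b" using B(1) x by blast+
  then show False using y by simp
qed

text \<open>The description of principal right ideals, applied to the group \<open>H\<close>; the
  translates over \<open>H\<close> are then replaced by those over \<open>G\<close>, so that
  \<open>cKH\<close> and \<open>cKG\<close> are compared inside one space.\<close>

lemma subalgebra_l_coset_eq_span:
  assumes fin: "finite (carrier G)" and H: "subgroup H G"
    and c: "c \<in> carrier (group_algebra (G\<lparr>carrier := H\<rparr>))"
  shows "c <#\<^bsub>group_algebra (G\<lparr>carrier := H\<rparr>)\<^esub> carrier (group_algebra (G\<lparr>carrier := H\<rparr>))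
       = fn.span ((\<lambda>h. right_translate G h c) ` H)"
proof -
  have "finite H" using H fin by (meson subgroup.subset finite_subset)
  then show ?thesis
    using group.group_algebra_l_coset_eq_span[OF subgroup_imp_group[OF H], of c]
      right_translate_subgroup[OF H _ c]
    by (simp cong: image_cong)
qed

section \<open>The minimum distance\<close>

lemma finite_weights:
  fixes C :: "('a \<Rightarrow> 'k::field) set"
  assumes fin: "finite (carrier G)"
  shows "finite {weight G c |c. c \<in> C \<and> c \<noteq> \<zero>\<^bsub>group_algebra G\<^esub>}"
proof -
  have "weight G f \<le> order G" for f :: "'a \<Rightarrow> 'k"
    unfolding weight_def order_def by (rule card_mono[OF fin]) auto
  then show ?thesis
    by (auto intro: finite_subset[OF _ finite_atMost])
qed

lemma min_distance_le:
  assumes "finite (carrier G)" "f \<in> C" "f \<noteq> 0"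
  shows "min_distance G C \<le> weight G f"
  unfolding min_distance_def by (rule Min_le[OF finite_weights]) (use assms in auto)

lemma min_distance_attained:
  assumes fin: "finite (carrier G)" and C: "right_ideal C (group_algebra G)"
    and ne: "C \<noteq> {\<zero>\<^bsub>group_algebra G\<^esub>}"
  obtains c where "c \<in> C" "c \<noteq> 0" "weight G c = min_distance G C"
proof -
  let ?W = "{weight G c |c. c \<in> C \<and> c \<noteq> \<zero>\<^bsub>group_algebra G\<^esub>}"
  have "0 \<in> C" using right_ideal_subspace[OF fin C] by (rule fn.subspace_0)
  then have "?W \<noteq> {}" using ne by auto
  then have "min_distance G C \<in> ?W"
    unfolding min_distance_def by (rule Min_in[OF finite_weights[OF fin]])
  then show thesis using that by auto
qed

section \<open>From equality to a subgroup\<close>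

lemma tight_code_from_subgroup:
  assumes fin: "finite (carrier G)" and C: "right_ideal C (group_algebra G)"
    and ne: "C \<noteq> {\<zero>\<^bsub>group_algebra G\<^esub>}"
    and eq: "min_distance G C * fn.dim C = order G"
  obtains H c where "subgroup H G" "c \<in> carrier (group_algebra (G\<lparr>carrier := H\<rparr>))"
    "card H = min_distance G C"
    "fn.dim (c <#\<^bsub>group_algebra (G\<lparr>carrier := H\<rparr>)\<^esub> carrier (group_algebra (G\<lparr>carrier := H\<rparr>))) = 1"
    "C = c <#\<^bsub>group_algebra G\<^esub> carrier (group_algebra G)"
proof -
  note ideal = right_ideal_group_algebra[OF fin C]
  let ?d = "min_distance G C"
  obtain c0 where c0: "c0 \<in> C" "c0 \<noteq> 0" "weight G c0 = ?d"
    by (rule min_distance_attained[OF fin C ne])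
  obtain y where y: "c0 y \<noteq> 0" using c0(2) by (auto simp: fun_eq_iff)
  with ideal(1)[OF c0(1)] have yG: "y \<in> carrier G" by auto
  \<comment> \<open>Translation by \<open>inv y\<close> moves the support point \<open>y\<close> of
    \<open>c0\<close> to \<open>\<one>\<close>.\<close>
  define c where "c = right_translate G (inv y) c0"
  have c: "c \<in> C" and wc: "weight G c = ?d"
    using c0 yG ideal(2) by (simp_all add: c_def weight_right_translate)
  have c1: "c \<one> \<noteq> 0" using y yG by (simp add: c_def right_translate_def)
  then have cne: "c \<noteq> 0" by auto
  have carr: "c x = 0" if "x \<notin> carrier G" for x using ideal(1)[OF c] that by simp
  have tight: "weight G c * fn.dim C = order G" using eq wc by simp
  define H where "H = {g \<in> carrier G. c g \<noteq> 0}"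
  \<comment> \<open>The translates of \<open>c\<close> by \<open>h\<close> and by
    \<open>\<one>\<close> are both nonzero at \<open>\<one>\<close>, so their supports
    coincide.\<close>
  have shift: "c (x \<otimes> inv h) = 0 \<longleftrightarrow> c x = 0" if "inv h \<in> H" "h \<in> carrier G" "x \<in> carrier G" for h x
  proof -
    have "right_translate G h c \<one> \<noteq> 0" "right_translate G \<one> c \<one> \<noteq> 0"
      using that c1 by (auto simp: right_translate_def H_def)
    from tight_translates_support[OF fin C c cne tight that(2) one_closed this, of x] that(3)
    show ?thesis by (simp add: right_translate_def)
  qed
  have H: "subgroup H G"
  proof (rule subgroupI)
    show "H \<subseteq> carrier G" "H \<noteq> {}" using c1 by (auto simp: H_def)
    fix h assume h: "h \<in> H"
    then have hG: "h \<in> carrier G" by (simp add: H_def)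
    \<comment> \<open>With \<open>inv h\<close> for both variables, \<open>shift\<close> compares
      \<open>c \<one>\<close> with \<open>c (inv h)\<close>.\<close>
    show "inv h \<in> H"
      using shift[of "inv h" "inv h"] h hG c1 by (simp add: H_def)
    fix x assume "x \<in> H"
    then show "x \<otimes> h \<in> H"
      using shift[of "inv h" x] h hG by (simp add: H_def)
  qed
  have proportional: "right_translate G h c \<in> fn.span {c}" if h: "h \<in> H" for h
  proof -
    have hG: "h \<in> carrier G" and h': "inv h \<in> H"
      using h H by (auto simp: subgroup.mem_carrier subgroup.m_inv_closed)
    \<comment> \<open>The scalar is chosen so that \<open>u\<close> vanishes at
      \<open>\<one>\<close>. The support of \<open>u\<close> lies in that of \<open>c\<close> and
      misses \<open>\<one>\<close>, so minimality of the distance forces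
      \<open>u = 0\<close>.\<close>
    define a where "a = right_translate G h c \<one> / c \<one>"
    define u where "u = right_translate G h c - scale_fun a c"
    have "u \<in> C"
      unfolding u_def using ideal(2)[OF c hG] ideal(3) c
      by (intro fn.subspace_diff fn.subspace_scale)
    moreover have "weight G u < ?d"
    proof -
      have "u x = 0" if "x \<in> carrier G" "c x = 0" for x
        using shift[OF h' hG that(1)] that by (simp add: u_def right_translate_def)
      moreover have "u \<one> = 0" using c1 by (simp add: u_def a_def)
      ultimately have "{x \<in> carrier G. u x \<noteq> 0} \<subset> {x \<in> carrier G. c x \<noteq> 0}"
        using c1 by auto
      then show ?thesis
        unfolding wc[symmetric] weight_def using fin by (intro psubset_card_mono) auto
    qed
    ultimately have "u = 0" using min_distance_le[OF fin, of u C] by fastforce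
    then show ?thesis by (auto simp: u_def fn.span_singleton)
  qed
  have cH: "c \<in> carrier (group_algebra (G\<lparr>carrier := H\<rparr>))"
    using carr by (auto simp: H_def)
  \<comment> \<open>Puts \<open>c\<close> among its translates by \<open>H\<close>, which makes
    \<open>{c}\<close> a basis of their span.\<close>
  have "c = right_translate G \<one> c" using ideal(1)[OF c] by (simp add: right_translate_one)
  then have "c \<in> (\<lambda>h. right_translate G h c) ` H" using H by (auto simp: subgroup.one_closed)
  then have "fn.dim ((\<lambda>h. right_translate G h c) ` H) = 1"
    by (intro fn.dim_unique[of "{c}"]) (use cne proportional in auto)
  then have one: "fn.dim (c <#\<^bsub>group_algebra (G\<lparr>carrier := H\<rparr>)\<^esub>
      carrier (group_algebra (G\<lparr>carrier := H\<rparr>))) = 1"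
    by (simp only: subalgebra_l_coset_eq_span[OF fin H cH] fn.dim_span)
  \<comment> \<open>Needed only for \<open>fn.span B = C\<close>: the translates of this one word
    already generate the code.\<close>
  obtain B where B: "{} \<subseteq> B" "B \<subseteq> (\<lambda>g. right_translate G g c) ` carrier G" "fn.span B = C"
    "\<forall>x\<in>carrier G. card {b \<in> B. b x \<noteq> 0} = 1"
    by (rule tight_translate_basis[OF fin C c cne fn.independent_empty empty_subsetI tight])
  have "C = fn.span ((\<lambda>g. right_translate G g c) ` carrier G)"
    using fn.span_mono[OF B(2)] B(3) ideal(2)[OF c] ideal(3)
    by (intro antisym fn.span_minimal) auto
  moreover have "card H = ?d" using wc by (simp add: H_def weight_def)
  ultimately show thesis
    using that[OF H cH _ one] group_algebra_l_coset_eq_span[OF fin, of c] by simp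
qed

section \<open>From a subgroup to equality\<close>

text \<open>The general bound at a word of minimum weight gives one inequality. For the other, one
  translate of \<open>c\<close> per right coset of \<open>H\<close> suffices to span
  \<open>C\<close>, so the dimension is at most the index of \<open>H\<close>.\<close>

lemma tight_code_if_subgroup:
  assumes fin: "finite (carrier G)" and C: "right_ideal C (group_algebra G)"
    and ne: "C \<noteq> {\<zero>\<^bsub>group_algebra G\<^esub>}"
    and H: "subgroup H G" and cH: "c \<in> carrier (group_algebra (G\<lparr>carrier := H\<rparr>))"
    and card: "card H = min_distance G C"
    and dim1: "fn.dim (c <#\<^bsub>group_algebra (G\<lparr>carrier := H\<rparr>)\<^esub> carrier (group_algebra (G\<lparr>carrier := H\<rparr>))) = 1"
    and gen: "C = c <#\<^bsub>group_algebra G\<^esub> carrier (group_algebra G)"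
  shows "min_distance G C * fn.dim C = order G"
proof -
  let ?d = "min_distance G C"
  obtain c0 where c0: "c0 \<in> C" "c0 \<noteq> 0" "weight G c0 = ?d"
    by (rule min_distance_attained[OF fin C ne])
  have one: "fn.dim (fn.span ((\<lambda>h. right_translate G h c) ` H)) = 1"
    using dim1 by (simp only: subalgebra_l_coset_eq_span[OF fin H cH])
  have CG: "C = fn.span ((\<lambda>g. right_translate G g c) ` carrier G)"
    using gen by (simp only: group_algebra_l_coset_eq_span[OF fin])
  have "c \<in> carrier (group_algebra G)" using cH subgroup.subset[OF H] by auto
  then have "right_translate G \<one> c = c" by (rule right_translate_one)
  then have cT: "c \<in> (\<lambda>h. right_translate G h c) ` H"
    using subgroup.one_closed[OF H] by force
  \<comment> \<open>A basis of the line \<open>cKH\<close>; once \<open>c\<close> is known to be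
    nonzero, \<open>c\<close> can replace \<open>b\<close> as its generator.\<close>
  obtain b where b: "(\<lambda>h. right_translate G h c) ` H \<subseteq> fn.span {b}"
    using fn.basis_exists[of "(\<lambda>h. right_translate G h c) ` H"] one
    by (metis fn.dim_span card_1_singletonE)
  have "c \<noteq> 0"
  proof
    assume "c = 0"
    then have "C \<subseteq> {0}" unfolding CG
      by (intro fn.span_minimal fn.subspace_single_0) (auto simp: right_translate_def fun_eq_iff)
    then show False using c0 by auto
  qed
  have proportional: "\<exists>a. right_translate G h c = scale_fun a c" if "h \<in> H" for h
  proof -
    obtain s where s: "c = scale_fun s b"
      using b cT by (auto simp: fn.span_singleton)
    obtain t where t: "right_translate G h c = scale_fun t b"
      using b \<open>h \<in> H\<close> by (auto simp: fn.span_singleton)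
    have "s \<noteq> 0" using s \<open>c \<noteq> 0\<close> by auto
    then have "right_translate G h c = scale_fun (t / s) c"
      unfolding t by (subst s) (simp add: fun_eq_iff)
    then show ?thesis ..
  qed
  \<comment> \<open>A choice of coset representatives; \<open>?R\<close> contains one translate of
    \<open>c\<close> for each right coset.\<close>
  define r where "r X = (SOME x. x \<in> X)" for X :: "'a set"
  let ?R = "(\<lambda>X. right_translate G (r X) c) ` (rcosets H)"
  have finR: "finite (rcosets H)"
    using rcosets_subset_PowG[OF H] fin by (meson finite_Pow_iff finite_subset)
  have "right_translate G g c \<in> fn.span ?R" if g: "g \<in> carrier G" for g
  proof -
    have X: "H #> g \<in> rcosets H" using subgroup.subset[OF H] g by (rule rcosetsI)
    have "r (H #> g) \<in> H #> g"
      unfolding r_def using rcos_self[OF g H] by (rule someI)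
    then have rG: "r (H #> g) \<in> carrier G" and "H #> g = H #> r (H #> g)"
      using g H subgroup.elemrcos_carrier[OF H is_group] repr_independence by auto
    then have "g \<in> H #> r (H #> g)" using rcos_self[OF g H] by simp
    \<comment> \<open>Writing \<open>g\<close> as \<open>h\<close> times the representative of its
      coset, translation by \<open>h\<close> acts first and only scales \<open>c\<close>.\<close>
    then obtain h where h: "h \<in> H" "g = h \<otimes> r (H #> g)" by (auto simp: r_coset_def)
    obtain a where "right_translate G h c = scale_fun a c" using proportional[OF h(1)] ..
    then have "right_translate G g c = scale_fun a (right_translate G (r (H #> g)) c)"
      by (subst h(2)) (simp add: right_translate_mult subgroup.mem_carrier[OF H h(1)] rG right_translate_scale)
    then show ?thesis using X by (simp add: fn.span_scale fn.span_base)
  qed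
  then have "C \<subseteq> fn.span ?R"
    unfolding CG by (intro fn.span_minimal fn.subspace_span) auto
  then have "fn.dim C \<le> card ?R" using finR by (intro fn.dim_le_card) auto
  also have "\<dots> \<le> card (rcosets H)" using finR by (rule card_image_le)
  \<comment> \<open>Lagrange: the number of right cosets times \<open>card H\<close>, which is
    \<open>?d\<close>, equals \<open>order G\<close>.\<close>
  finally have "?d * fn.dim C \<le> order G"
    using lagrange[OF H] card by (metis mult.commute mult_le_mono1)
  moreover have "order G \<le> ?d * fn.dim C"
    using order_le_weight_times_dim[OF fin C c0(1,2)] c0(3) by simp
  ultimately show ?thesis by simp
qed

end

theorem theorem2p10:
  fixes G :: "('g, 'm) monoid_scheme" and C :: "('g \<Rightarrow> 'k::field) set"
  assumes "group G" and "finite (carrier G)"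
    and "right_ideal C (group_algebra G)"
    and "C \<noteq> {\<zero>\<^bsub>group_algebra G\<^esub>}"
  shows "min_distance G C * vector_space.dim scale_fun C = order G \<longleftrightarrow>
    (\<exists>H c. subgroup H G \<and>
       c \<in> carrier (group_algebra (G\<lparr>carrier := H\<rparr>)) \<and>
       card H = min_distance G C \<and>
       vector_space.dim scale_fun
         (c <#\<^bsub>group_algebra (G\<lparr>carrier := H\<rparr>)\<^esub> carrier (group_algebra (G\<lparr>carrier := H\<rparr>))) = 1 \<and>
       C = c <#\<^bsub>group_algebra G\<^esub> carrier (group_algebra G))"
proof -
  interpret group G by (rule assms(1))
  note G = assms(2-4)
  show ?thesis
    using tight_code_from_subgroup[OF G] tight_code_if_subgroup[OF G] by metis
qed

end
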